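(* Let $n$ be a positive integer and $p,q\in\mathbb{N}_0$. Then \begin{align*} \sum_{k=1}^n\frac{(-1)^k}{\binom{p+q+n}{q+k}}H_{p+n-k}H_{q+k} &=\left\{H_{p}H_{q+n+1}-\frac{H_{p}}{p+q+n+2}-\frac{H_{q+n+1}}{p+q+n+2}+\frac{2}{(p+q+n+2)^2}\right\}\frac{(-1)^n}{\binom{p+q+n}{p}}\,\frac{q+n+1}{p+q+n+2}\\ &\quad-\frac{1}{\binom{p+q+n}{q}}\,\frac{q+1}{p+q+n+2}\left\{H_{p+n}H_{q+1}-\frac{H_{p+n}}{p+q+n+2}-\frac{H_{q+1}}{p+q+n+2}+\frac{2}{(p+q+n+2)^2}\right\}. \end{align*}
   Context: $H_0=0$ and $H_m=\sum_{j=1}^m \frac1j$ for $m\ge1$. $\binom{a}{b}$ is the usual binomial coefficient. *)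

theory Defs
  imports "HOL-Analysis.Harmonic_Numbers"
begin

end

theory Submission
  imports Defs
begin

text \<open>
  The sum telescopes: with \<open>i = p + n - k\<close> and \<open>j = q + k\<close>, the summand without its sign is
  \<open>antidiff i j + antidiff (i + 1) (j - 1)\<close>, and the right-hand side consists of the two boundary terms.
\<close>

definition antidiff :: "nat \<Rightarrow> nat \<Rightarrow> real" where
  "antidiff i j =
    (harm i * harm (j + 1) - harm i / real (i + j + 2)
      - harm (j + 1) / real (i + j + 2) + 2 / (real (i + j + 2))\<^sup>2)
    * (real (j + 1) / real (i + j + 2)) / real ((i + j) choose j)"

text \<open>After division by the binomials, the two brackets are averaged with weights
  \<open>(j + 2) / (i + j + 3)\<close> and \<open>(i + 1) / (i + j + 3)\<close>. With
  \<open>s = i + j + 3\<close>, the products of harmonic numbers average to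
  \<open>harm i * harm (Suc j)\<close> plus \<open>(harm i + harm (Suc j)) / s\<close>. The linear
  terms cancel this surplus and leave \<open>- 2 / s\<^sup>2\<close>, which the last term of the
  bracket removes.\<close>

lemma antidiff_step:
  "antidiff i (Suc j) + antidiff (Suc i) j = harm i * harm (Suc j) / real ((i + Suc j) choose Suc j)"
proof -
  define a b C where "a = (harm i :: real)" and "b = (harm (Suc j) :: real)"
    and "C = real ((i + Suc j) choose Suc j)"
  \<comment> \<open>\<open>1 / x\<close> and \<open>1 / y\<close> are the increments of the two
    harmonic numbers; \<open>x + y\<close> is the denominator common to both terms.\<close>
  define x y where "x = real i + 1" and "y = real j + 2"
  have pos: "x > 0" "y > 1" "C > 0"
    by (simp_all add: x_def y_def C_def zero_less_binomial_iff del: binomial_Suc_Suc)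
  \<comment> \<open>By absorption, both sides equal
    \<open>Suc (i + j) * ((i + j) choose j)\<close>.\<close>
  have "Suc j * ((i + Suc j) choose Suc j) = Suc i * ((Suc i + j) choose j)"
    using binomial_absorb_comp[of "Suc (i + j)" j] binomial_absorption[of j "Suc (i + j)"]
    by simp
  then have "real (Suc j) * C = real (Suc i) * real ((Suc i + j) choose j)"
    unfolding C_def by (metis of_nat_mult)
  then have C': "real ((Suc i + j) choose j) = (y - 1) * C / x"
    using pos by (simp add: x_def y_def field_simps)
  have H: "harm (Suc i) = a + 1 / x" "harm (Suc j + 1) = b + 1 / y" "harm (j + 1) = b"
    by (simp_all add: a_def b_def x_def y_def harm_Suc inverse_eq_divide add_ac)
  have N: "real (i + Suc j + 2) = x + y" "real (Suc i + j + 2) = x + y"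
    "real (Suc j + 1) = y" "real (j + 1) = y - 1"
    by (simp_all add: x_def y_def)
  \<comment> \<open>By \<open>C'\<close>, the factor \<open>y - 1\<close> of the second term over
    its binomial becomes \<open>x / C\<close>, so both terms share the denominator
    \<open>(x + y) * C\<close>.\<close>
  have "antidiff i (Suc j) + antidiff (Suc i) j =
    ((a * (b + 1 / y) - a / (x + y) - (b + 1 / y) / (x + y) + 2 / (x + y)\<^sup>2) * y
      + ((a + 1 / x) * b - (a + 1 / x) / (x + y) - b / (x + y) + 2 / (x + y)\<^sup>2) * x)
    / ((x + y) * C)"
    using pos unfolding antidiff_def H N C' a_def[symmetric] b_def[symmetric] C_def[symmetric]
    by (simp add: add_divide_distrib ac_simps)
  also have "\<dots> = a * b / C"
    using pos by (simp add: divide_simps) algebra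
  finally show ?thesis
    by (simp add: a_def b_def C_def)
qed

theorem theorem5:
  fixes n p q :: nat
  assumes "n > 0"
  shows "(\<Sum>k=1..n. (-1) ^ k / real ((p + q + n) choose (q + k)) * harm (p + n - k) * harm (q + k)) =
      (harm p * harm (q + n + 1) - harm p / real (p + q + n + 2)
          - harm (q + n + 1) / real (p + q + n + 2) + 2 / (real (p + q + n + 2))\<^sup>2)
        * ((-1) ^ n / real ((p + q + n) choose p)) * (real (q + n + 1) / real (p + q + n + 2))
      - 1 / real ((p + q + n) choose q) * (real (q + 1) / real (p + q + n + 2))
        * (harm (p + n) * harm (q + 1) - harm (p + n) / real (p + q + n + 2)
          - harm (q + 1) / real (p + q + n + 2) + 2 / (real (p + q + n + 2))\<^sup>2)"
proof -
  \<comment> \<open>The alternating sign turns the sum in \<open>antidiff_step\<close> into a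
    difference of consecutive values.\<close>
  define F where "F k = (-1) ^ k * antidiff (p + n - k) (q + k)" for k
  have "(-1) ^ k / real ((p + q + n) choose (q + k)) * harm (p + n - k) * harm (q + k)
      = F k - F (k - 1)" if k: "k \<in> {Suc 0..n}" for k
  proof -
    obtain l where l: "k = Suc l"
      using k by (cases k) auto
    define i where "i = p + n - Suc l"
    \<comment> \<open>Since \<open>Suc l \<le> n\<close>, the subtraction defining \<open>i\<close>
      is not truncated.\<close>
    have i: "p + n - l = Suc i" "p + q + n = i + Suc (q + l)"
      using k l by (auto simp: i_def)
    have "F k - F (k - 1) = (-1) ^ k * (antidiff i (Suc (q + l)) + antidiff (Suc i) (q + l))"
      by (simp add: F_def l i(1) i_def[symmetric] ring_distribs)
    then show ?thesis
      by (simp only: antidiff_step i(2)) (simp add: l i_def)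
  qed
  then have "(\<Sum>k=1..n. (-1) ^ k / real ((p + q + n) choose (q + k)) * harm (p + n - k) * harm (q + k))
      = (\<Sum>k=Suc 0..n. F k - F (k - 1))"
    by (intro sum.cong) auto
  also have "\<dots> = F n - F 0"
    by (rule sum_telescope'') simp
  also have "F n = (harm p * harm (q + n + 1) - harm p / real (p + q + n + 2)
          - harm (q + n + 1) / real (p + q + n + 2) + 2 / (real (p + q + n + 2))\<^sup>2)
        * ((-1) ^ n / real ((p + q + n) choose p)) * (real (q + n + 1) / real (p + q + n + 2))"
  proof -
    \<comment> \<open>\<open>F n\<close> carries the lower index \<open>q + n\<close>, the claim its
      complement \<open>p\<close>.\<close>
    have "(p + q + n) choose p = (p + (q + n)) choose (q + n)"
      using binomial_symmetric[of p "p + q + n"] by (simp add: add.assoc)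
    then show ?thesis
      by (simp add: F_def antidiff_def ac_simps)
  qed
  also have "F 0 = 1 / real ((p + q + n) choose q) * (real (q + 1) / real (p + q + n + 2))
        * (harm (p + n) * harm (q + 1) - harm (p + n) / real (p + q + n + 2)
          - harm (q + 1) / real (p + q + n + 2) + 2 / (real (p + q + n + 2))\<^sup>2)"
    by (simp add: F_def antidiff_def ac_simps)
  finally show ?thesis .
qed

end
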